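(* Let $n,k,t$ be positive integers with $1\leq k\leq n$. If $n<kt$, then $ar_{tr}(U_{k,n},t)=n$. Otherwise, $ar_{tr}(U_{k,n},t)=t(k-1)$.
   Context: $U_{k,n}$ is the uniform matroid on ground set $[n]=\{1,\dots,n\}$ whose bases are exactly the $k$-element subsets of $[n]$. Given a coloring of $[n]$, a rainbow basis is a basis whose elements have pairwise distinct colors. $ar_{tr}(U_{k,n},t)$ is the maximum number $m$ such that there is a coloring of $[n]$ using exactly $m$ colors with no $t$ pairwise disjoint rainbow bases. *)

theory Defs
  imports Main "HOL-Library.Disjoint_Sets"
begin

text \<open>A matroid is given by its ground set \<open>E\<close> and its collection of bases \<open>\<B>\<close>.\<close>

definition is_matroid :: "'a set \<Rightarrow> 'a set set \<Rightarrow> bool" where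
  "is_matroid E \<B> \<longleftrightarrow> finite E \<and> \<B> \<subseteq> Pow E \<and> \<B> \<noteq> {} \<and>
     (\<forall>A\<in>\<B>. \<forall>B\<in>\<B>. \<forall>x\<in>A - B. \<exists>y\<in>B - A. insert y (A - {x}) \<in> \<B>)"

definition uniform_bases :: "nat \<Rightarrow> nat \<Rightarrow> nat set set" where
  "uniform_bases k n = {B. B \<subseteq> {1..n} \<and> card B = k}"

lemma is_matroid_uniform:
  assumes "k \<le> n"
  shows "is_matroid {1..n} (uniform_bases k n)"
  unfolding is_matroid_def
proof (intro conjI ballI)
  show "uniform_bases k n \<noteq> {}"
    using obtain_subset_with_card_n[of k "{1..n}"] assms
    by (auto simp: uniform_bases_def)
next
  fix A B x
  assume A: "A \<in> uniform_bases k n" and B: "B \<in> uniform_bases k n" and x: "x \<in> A - B"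
  have fin: "finite A" "finite B"
    using A B by (auto simp: uniform_bases_def intro: finite_subset)
  have "\<not> B \<subseteq> A"
    using A B x fin card_subset_eq[of A B] by (auto simp: uniform_bases_def)
  then obtain y where y: "y \<in> B - A"
    by auto
  have "card (insert y (A - {x})) = card A"
    using x y fin card_Suc_Diff1[of A x] by (simp del: card_Diff_insert card_Diff_singleton)
  then have "insert y (A - {x}) \<in> uniform_bases k n"
    using A B y by (auto simp: uniform_bases_def)
  then show "\<exists>y\<in>B - A. insert y (A - {x}) \<in> uniform_bases k n"
    using y by blast
qed (auto simp: uniform_bases_def)

definition rainbow_bases :: "'a set set \<Rightarrow> ('a \<Rightarrow> nat) \<Rightarrow> 'a set set" where
  "rainbow_bases \<B> c = {B \<in> \<B>. inj_on c B}"

definition has_disjoint_rainbow_bases :: "'a set set \<Rightarrow> ('a \<Rightarrow> nat) \<Rightarrow> nat \<Rightarrow> bool" where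
  "has_disjoint_rainbow_bases \<B> c t \<longleftrightarrow>
     (\<exists>F \<subseteq> rainbow_bases \<B> c. finite F \<and> card F = t \<and> disjoint F)"

definition avoiding_color_counts :: "'a set \<Rightarrow> 'a set set \<Rightarrow> nat \<Rightarrow> nat set" where
  "avoiding_color_counts E \<B> t =
     {m. \<exists>c :: 'a \<Rightarrow> nat. card (c ` E) = m \<and> \<not> has_disjoint_rainbow_bases \<B> c t}"

text \<open>The maximum over the empty set is \<open>0\<close> by convention. The convention is needed: for
  \<open>k = 1\<close> and \<open>n \<ge> t\<close> every coloring of the uniform matroid has \<open>t\<close> disjoint rainbow
  bases, and \<open>t * (k - 1) = 0\<close>.\<close>

definition ar_tr :: "'a set \<Rightarrow> 'a set set \<Rightarrow> nat \<Rightarrow> nat" where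
  "ar_tr E \<B> t =
     (if avoiding_color_counts E \<B> t = {} then 0 else Max (avoiding_color_counts E \<B> t))"

lemma finite_avoiding_color_counts:
  assumes "finite E"
  shows "finite (avoiding_color_counts E \<B> t)"
  by (rule finite_subset[of _ "{..card E}"])
    (auto simp: avoiding_color_counts_def card_image_le assms)

end

theory Submission imports Defs begin

text \<open>
  If \<open>n < k * t\<close>, there is no room for \<open>t\<close> disjoint bases, so the injective coloring avoids them.
  If \<open>n \<ge> k * t\<close> and \<open>k \<ge> 2\<close>, the coloring with one large class and \<open>t * (k - 1) - 1\<close> singletons avoids them,
  since every rainbow basis uses at least \<open>k - 1\<close> of the singletons. Conversely, given more than
  \<open>t * (k - 1)\<close> colors, there is a set of \<open>k * t\<close> elements containing every color at most \<open>t\<close> times: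
  if no class exceeds \<open>t\<close> any such set will do, otherwise take \<open>t\<close> elements of a large class and
  representatives of \<open>t * (k - 1)\<close> other colors. List this set with equal colors adjacent; elements
  whose positions agree modulo \<open>t\<close> then have distinct colors, so the residue classes of positions
  are \<open>t\<close> disjoint rainbow \<open>k\<close>-sets.
\<close>

lemma disjoint_rainbow_sets_if_small_classes:
  fixes c :: "'a \<Rightarrow> nat"
  assumes fin: "finite S" and card: "card S = k * t" and k: "1 \<le> k"
    and small: "\<And>s. card {x \<in> S. c x = s} \<le> t"
  obtains F where "\<And>B. B \<in> F \<Longrightarrow> B \<subseteq> S \<and> card B = k \<and> inj_on c B"
    "finite F" "card F = t" "disjoint F"
proof -
  obtain ys where ys: "set ys = S" "distinct ys"
    using finite_distinct_list[OF fin] by blast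
  define xs where "xs = sort_key c ys"
  have set_xs: "set xs = S" and dist: "distinct xs" and sorted: "sorted (map c xs)"
    using ys by (auto simp: xs_def)
  have len: "length xs = k * t"
    using distinct_card[OF dist] set_xs card by simp
  \<comment> \<open>The sorted list splits into \<open>k\<close> consecutive blocks of length
    \<open>t\<close>; position \<open>q * t + j\<close> is entry \<open>j\<close> of block
    \<open>q\<close>. Each set \<open>B j\<close> below takes entry \<open>j\<close> from every
    block.\<close>
  have pos: "q * t + j < length xs" if "q < k" "j < t" for q j
  proof -
    have "q * t + j < Suc q * t" using that by simp
    also have "\<dots> \<le> k * t" using that by (intro mult_le_mono1) simp
    finally show ?thesis by (simp add: len)
  qed
  have pos_eq: "q = q' \<and> j = j'"
    if "xs ! (q * t + j) = xs ! (q' * t + j')" "q < k" "j < t" "q' < k" "j' < t" for q q' j j'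
  proof -
    have eq: "q * t + j = q' * t + j'"
      using that pos dist by (simp add: nth_eq_iff_index_eq)
    have "q = (q * t + j) div t" "q' = (q' * t + j') div t"
      "j = (q * t + j) mod t" "j' = (q' * t + j') mod t"
      using that by auto
    with eq show ?thesis by metis
  qed
  \<comment> \<open>Two such positions are at least \<open>t\<close> apart. If their colors agreed,
    sortedness would force that color on the whole stretch between them, which has at least
    \<open>t + 1\<close> distinct elements, contradicting \<open>small\<close>.\<close>
  have far: "c (xs ! (q * t + j)) \<noteq> c (xs ! (q' * t + j))" if "q < q'" "q' < k" "j < t" for q q' j
  proof
    let ?a = "q * t + j" and ?b = "q' * t + j"
    assume eq: "c (xs ! ?a) = c (xs ! ?b)"
    have "Suc q * t \<le> q' * t" using that by (intro mult_le_mono1) simp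
    then have gap: "?a + t \<le> ?b" by simp
    have b: "?b < length xs" using pos that by simp
    have mono: "c (xs ! i) \<le> c (xs ! i')" if "i \<le> i'" "i' < length xs" for i i'
      using sorted_nth_mono[OF sorted, of i i'] that by simp
    have "(!) xs ` {?a..?b} \<subseteq> {x \<in> S. c x = c (xs ! ?a)}"
    proof
      fix x assume "x \<in> (!) xs ` {?a..?b}"
      then obtain i where i: "?a \<le> i" "i \<le> ?b" "x = xs ! i" by auto
      then have "c (xs ! ?a) \<le> c x" "c x \<le> c (xs ! ?b)" "x \<in> S"
        using mono b set_xs by auto
      then show "x \<in> {x \<in> S. c x = c (xs ! ?a)}" using eq by simp
    qed
    then have "card ((!) xs ` {?a..?b}) \<le> card {x \<in> S. c x = c (xs ! ?a)}"
      using fin by (intro card_mono) auto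
    moreover have "card ((!) xs ` {?a..?b}) = card {?a..?b}"
      using b dist by (intro card_image inj_on_nth) auto
    ultimately show False using small[of "c (xs ! ?a)"] gap by simp
  qed
  define B where "B j = (\<lambda>q. xs ! (q * t + j)) ` {..<k}" for j
  show thesis
  proof
    show "X \<subseteq> S \<and> card X = k \<and> inj_on c X" if X: "X \<in> B ` {..<t}" for X
    proof -
      obtain j where j: "j < t" "X = B j" using X by auto
      have "X \<subseteq> S" using j pos nth_mem set_xs by (auto simp: B_def)
      moreover have "inj_on (\<lambda>q. xs ! (q * t + j)) {..<k}"
        using j(1) pos_eq by (intro inj_onI) (metis lessThan_iff)
      then have "card X = k"
        using j by (simp add: B_def card_image)
      moreover have "inj_on c X"
      proof (rule inj_onI)
        fix x y assume "x \<in> X" "y \<in> X" and eq: "c x = c y"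
        then obtain q q' where "q < k" "x = xs ! (q * t + j)" "q' < k" "y = xs ! (q' * t + j)"
          using j by (auto simp: B_def)
        with eq j(1) far show "x = y" by (metis linorder_neqE_nat)
      qed
      ultimately show ?thesis by blast
    qed
    have disj: "B j \<inter> B j' = {}" if "j \<noteq> j'" "j < t" "j' < t" for j j'
      using that by (auto simp: B_def dest: pos_eq)
    \<comment> \<open>Disjointness alone would let several \<open>B j\<close> coincide as the empty
      set; since \<open>1 \<le> k\<close>, they are nonempty, so the family has exactly
      \<open>t\<close> members.\<close>
    have ne: "B j \<noteq> {}" for j
      using k by (auto simp: B_def lessThan_empty_iff)
    have "inj_on B {..<t}"
      using disj ne by (metis inf.idem inj_onI lessThan_iff)
    then show "card (B ` {..<t}) = t" by (simp add: card_image)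
    show "disjoint (B ` {..<t})"
      using disj unfolding disjoint_def by (metis imageE lessThan_iff)
  qed simp
qed

lemma obtain_subset_with_small_classes:
  fixes c :: "'a \<Rightarrow> nat"
  assumes fin: "finite E" and room: "k * t \<le> card E" and k: "1 \<le> k" and t: "1 \<le> t"
    and colors: "t * (k - 1) < card (c ` E)"
  obtains S where "S \<subseteq> E" "card S = k * t" "\<And>s. card {x \<in> S. c x = s} \<le> t"
proof (cases "\<forall>s. card {x \<in> E. c x = s} \<le> t")
  case True
  obtain S where S: "S \<subseteq> E" "card S = k * t"
    using obtain_subset_with_card_n[OF room] by metis
  have "card {x \<in> S. c x = s} \<le> t" for s
  proof -
    have "card {x \<in> S. c x = s} \<le> card {x \<in> E. c x = s}"
      using S fin by (intro card_mono) auto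
    with True show ?thesis using le_trans by blast
  qed
  with S that show thesis by blast
next
  case False
  then obtain s0 where "t \<le> card {x \<in> E. c x = s0}" by (meson nat_le_linear)
  then obtain T where T: "T \<subseteq> {x \<in> E. c x = s0}" "card T = t"
    using obtain_subset_with_card_n by metis
  \<comment> \<open>The strict bound on the number of colors pays for discarding \<open>s0\<close>.
    Without that color in \<open>C\<close>, the class of \<open>s0\<close> in
    \<open>T \<union> R\<close> is exactly \<open>T\<close>.\<close>
  have "t * (k - 1) \<le> card (c ` E - {s0})"
    using colors fin card_Diff1_le[of "c ` E" s0]
    by (cases "s0 \<in> c ` E") (auto simp: card_Diff_singleton)
  then obtain C where C: "C \<subseteq> c ` E - {s0}" "card C = t * (k - 1)"
    using obtain_subset_with_card_n by metis
  have "C \<subseteq> c ` E" using C by blast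
  then obtain R where R: "R \<subseteq> E" "inj_on c R" "c ` R = C"
    unfolding subset_image_inj by auto
  have fins: "finite T" "finite R"
    using T R fin by (auto intro: finite_subset)
  have disj: "T \<inter> R = {}" using T R C by auto
  have "card R = t * (k - 1)" using card_image[OF R(2)] R(3) C(2) by simp
  then have "card (T \<union> R) = t + t * (k - 1)"
    using card_Un_disjoint[OF fins disj] T by simp
  also have "\<dots> = k * t" using k by (cases k) auto
  finally have card: "card (T \<union> R) = k * t" .
  have "card {x \<in> T \<union> R. c x = s} \<le> t" for s
  proof (cases "s = s0")
    case True
    then have "{x \<in> T \<union> R. c x = s} = T" using T R C by auto
    then show ?thesis using T by simp
  next
    case False
    then have "{x \<in> T \<union> R. c x = s} \<subseteq> {x \<in> R. c x = s}" using T by auto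
    then have "card {x \<in> T \<union> R. c x = s} \<le> card {x \<in> R. c x = s}"
      using fins by (intro card_mono) auto
    also have "\<dots> \<le> 1"
      using R(2) fins by (auto simp: card_le_Suc0_iff_eq inj_on_def)
    finally show ?thesis using t by simp
  qed
  moreover have "T \<union> R \<subseteq> E" using T R by auto
  ultimately show thesis using card that by blast
qed

lemma card_Union_disjoint_uniform_bases:
  assumes "F \<subseteq> uniform_bases k n" "disjoint F"
  shows "card (\<Union>F) = card F * k"
proof -
  have "card (\<Union>F) = sum card F"
    using assms by (intro card_Union_disjoint) (auto simp: uniform_bases_def intro: finite_subset)
  also have "\<dots> = (\<Sum>B\<in>F. k)"
    using assms by (intro sum.cong) (auto simp: uniform_bases_def)
  finally show ?thesis by simp
qed

lemma avoids_if_too_few_elements: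
  assumes "n < k * t"
  shows "\<not> has_disjoint_rainbow_bases (uniform_bases k n) c t"
proof
  assume "has_disjoint_rainbow_bases (uniform_bases k n) c t"
  then obtain F where F: "F \<subseteq> uniform_bases k n" "card F = t" "disjoint F"
    by (auto simp: has_disjoint_rainbow_bases_def rainbow_bases_def)
  have "card (\<Union>F) \<le> card {1..n}"
    using F by (intro card_mono) (auto simp: uniform_bases_def)
  with card_Union_disjoint_uniform_bases[OF F(1,3)] F(2) assms show False
    by (simp add: mult.commute)
qed

text \<open>Taking the minimum with \<open>m = t * (k - 1)\<close> merges all elements from
  \<open>m\<close> upwards into one class and leaves \<open>1, ..., m - 1\<close> as singletons. A
  rainbow basis has at most one element in the merged class, so \<open>t\<close> disjoint ones would
  cover at most \<open>t + (m - 1)\<close> elements, one fewer than the required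
  \<open>t * k\<close>.\<close>

lemma avoids_if_min_coloring:
  fixes k t n :: nat
  assumes t: "1 \<le> t" and k: "2 \<le> k"
  shows "\<not> has_disjoint_rainbow_bases (uniform_bases k n) (\<lambda>x. min x (t * (k - 1))) t"
proof
  let ?m = "t * (k - 1)"
  let ?c = "\<lambda>x. min x ?m"
  assume "has_disjoint_rainbow_bases (uniform_bases k n) ?c t"
  then obtain F where F: "F \<subseteq> uniform_bases k n" "finite F" "card F = t" "disjoint F"
    and inj: "\<And>B. B \<in> F \<Longrightarrow> inj_on ?c B"
    by (auto simp: has_disjoint_rainbow_bases_def rainbow_bases_def)
  have big: "card (B - {1..<?m}) \<le> 1" if B: "B \<in> F" for B
  proof -
    have "B \<subseteq> {1..n}" using F(1) B by (auto simp: uniform_bases_def)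
    then have "finite B" and ge: "\<And>x. x \<in> B - {1..<?m} \<Longrightarrow> x \<in> B \<and> ?m \<le> x"
      by (auto intro: finite_subset)
    moreover have "x = y" if "x \<in> B - {1..<?m}" "y \<in> B - {1..<?m}" for x y
      using ge[OF that(1)] ge[OF that(2)] inj_onD[OF inj[OF B], of x y]
      by (simp add: min_absorb2)
    ultimately show ?thesis by (simp add: card_le_Suc0_iff_eq)
  qed
  have "\<Union>F - {1..<?m} = (\<Union>B\<in>F. B - {1..<?m})" by auto
  then have "card (\<Union>F - {1..<?m}) \<le> (\<Sum>B\<in>F. card (B - {1..<?m}))"
    using card_UN_le[OF F(2)] by metis
  also have "\<dots> \<le> (\<Sum>B\<in>F. 1)" using big by (intro sum_mono)
  finally have "card (\<Union>F - {1..<?m}) \<le> t" using F(3) by simp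
  moreover have "card (\<Union>F) \<le> card (\<Union>F - {1..<?m}) + card {1..<?m}"
    using diff_card_le_card_Diff[of "{1..<?m}" "\<Union>F"] by simp
  ultimately have "t * k \<le> t + (?m - 1)"
    using card_Union_disjoint_uniform_bases[OF F(1,4)] F(3) by simp
  moreover have "t * k = t + ?m" using k by (cases k) auto
  \<comment> \<open>Subtraction on naturals truncates, so \<open>?m - 1\<close> is smaller than
    \<open>?m\<close> only when \<open>?m\<close> is positive; this is where \<open>k = 1\<close>
    would fail.\<close>
  moreover have "0 < ?m" using t k by simp
  ultimately show False by linarith
qed

lemma has_disjoint_rainbow_bases_if_many_colors:
  assumes "k * t \<le> n" "1 \<le> k" "1 \<le> t" "t * (k - 1) < card (c ` {1..n})"
  shows "has_disjoint_rainbow_bases (uniform_bases k n) c t"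
proof -
  obtain S where S: "S \<subseteq> {1..n}" "card S = k * t" "\<And>s. card {x \<in> S. c x = s} \<le> t"
    using obtain_subset_with_small_classes[of "{1..n}" k t c] assms by auto
  then have "finite S" by (auto intro: finite_subset)
  then obtain F where F: "\<And>B. B \<in> F \<Longrightarrow> B \<subseteq> S \<and> card B = k \<and> inj_on c B"
    "finite F" "card F = t" "disjoint F"
    using disjoint_rainbow_sets_if_small_classes[of S k t c] S assms by metis
  then have "F \<subseteq> rainbow_bases (uniform_bases k n) c"
    using S(1) by (fastforce simp: rainbow_bases_def uniform_bases_def)
  with F show ?thesis by (auto simp: has_disjoint_rainbow_bases_def)
qed

lemma ar_tr_eqI:
  assumes "finite E" "m \<in> avoiding_color_counts E \<B> t"
    "\<And>m'. m' \<in> avoiding_color_counts E \<B> t \<Longrightarrow> m' \<le> m"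
  shows "ar_tr E \<B> t = m"
  using assms finite_avoiding_color_counts[OF assms(1), of \<B> t]
  by (auto simp: ar_tr_def intro: Max_eqI)

theorem theorem18:
  fixes n k t :: nat
  assumes "n \<ge> 1" and "t \<ge> 1" and "1 \<le> k" and "k \<le> n"
  shows "(n < k * t \<longrightarrow> ar_tr {1..n} (uniform_bases k n) t = n) \<and>
         (\<not> n < k * t \<longrightarrow> ar_tr {1..n} (uniform_bases k n) t = t * (k - 1))"
proof (intro conjI impI)
  let ?A = "avoiding_color_counts {1..n} (uniform_bases k n) t"
  {
    assume "n < k * t"
    then have "n \<in> ?A"
      using avoids_if_too_few_elements[of n k t "\<lambda>x. x"]
      by (auto simp: avoiding_color_counts_def intro!: exI[of _ "\<lambda>x. x"])
    moreover have "m \<le> n" if "m \<in> ?A" for m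
      using that card_image_le[of "{1..n}"] by (auto simp: avoiding_color_counts_def)
    ultimately show "ar_tr {1..n} (uniform_bases k n) t = n"
      by (intro ar_tr_eqI) auto
  next
    assume "\<not> n < k * t"
    then have room: "k * t \<le> n" by simp
    have upper: "m \<le> t * (k - 1)" if m: "m \<in> ?A" for m
      using m has_disjoint_rainbow_bases_if_many_colors[OF room assms(3,2)] not_le_imp_less
      by (auto simp: avoiding_color_counts_def)
    show "ar_tr {1..n} (uniform_bases k n) t = t * (k - 1)"
    proof (cases "k = 1")
      case True
      \<comment> \<open>For \<open>k = 1\<close> the upper bound allows only zero colors, while a
        nonempty ground set always shows at least one. So no coloring avoids, and the value is the
        default \<open>0\<close>.\<close>
      have "0 \<notin> ?A"
        using assms(1) by (simp add: avoiding_color_counts_def)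
      then have "?A = {}"
        using upper True by fastforce
      then show ?thesis using True by (simp add: ar_tr_def)
    next
      case False
      let ?m = "t * (k - 1)"
      \<comment> \<open>This ensures that the merged color \<open>?m\<close> is attained on the
        ground set, so that exactly \<open>?m\<close> colors occur.\<close>
      have "?m \<le> n" using room by (metis diff_le_self le_trans mult.commute mult_le_mono2)
      moreover have "1 \<le> ?m" using False assms by simp
      ultimately have "(\<lambda>x. min x ?m) ` {1..n} = {1..?m}"
        by (auto intro!: rev_image_eqI)
      then have "card ((\<lambda>x. min x ?m) ` {1..n}) = ?m" by simp
      moreover have "\<not> has_disjoint_rainbow_bases (uniform_bases k n) (\<lambda>x. min x ?m) t"
        using avoids_if_min_coloring False assms by simp
      ultimately have "?m \<in> ?A" unfolding avoiding_color_counts_def by blast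
      with upper show ?thesis by (intro ar_tr_eqI) auto
    qed
  }
qed

end
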